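(* Let $A\in\mathbb{R}^{n\times n}$, $B_1\in\mathbb{R}^{n\times m_1}$, $B_2\in\mathbb{R}^{n\times m_2}$, $C_1\in\mathbb{R}^{p_1\times n}$, $D_{11}\in\mathbb{R}^{p_1\times m_1}$, $D_{12}\in\mathbb{R}^{p_1\times m_2}$, and let $N_0=n+p_1+m_1$. Consider the control system $$\dot x=Ax+B_1w+B_2u,\qquad z=C_1x+D_{11}w+D_{12}u,$$ and the LMI problem $$\inf_{\gamma,X,Y}\ \gamma\quad\text{subject to}\quad -\begin{pmatrix}\mathrm{He}(AX+B_2Y)&(C_1X+D_{12}Y)^T&B_1\\ C_1X+D_{12}Y&-\gamma I_{p_1}&D_{11}\\ B_1^T&D_{11}^T&-\gamma I_{m_1}\end{pmatrix}\in\mathbb{S}^{N_0}_+,\quad \gamma\in\mathbb{R},\ X\in\mathbb{S}^n_+,\ Y\in\mathbb{R}^{m_2\times n}.$$ This LMI problem is strongly feasible if and only if the control system is stabilizable.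
   Context: $\mathbb{S}^k_+$ and $\mathbb{S}^k_{++}$ denote the sets of $k\times k$ real symmetric positive semidefinite and positive definite matrices; $\mathrm{He}(M)=M+M^T$. The LMI problem is strongly feasible if there exist $\gamma\in\mathbb{R}$, $X$, $Y\in\mathbb{R}^{m_2\times n}$ for which all semidefinite constraints hold strictly, i.e. $X\in\mathbb{S}^n_{++}$ and the displayed matrix (including the minus sign) lies in $\mathbb{S}^{N_0}_{++}$. The control system is stabilizable if $(A,B_2)$ is stabilizable, i.e. there is no $\lambda\in\mathbb{C}$ with nonnegative real part such that $\mathrm{rank}\begin{pmatrix}A-\lambda I_n&B_2\end{pmatrix}<n$. *)

theory Defs
  imports "HOL-Analysis.Analysis"
begin

definition psd_matrices :: "(real^'k^'k) set" where
  "psd_matrices = {M. transpose M = M \<and> (\<forall>x. x \<bullet> (M *v x) \<ge> 0)}"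

definition pd_matrices :: "(real^'k^'k) set" where
  "pd_matrices = {M. transpose M = M \<and> (\<forall>x. x \<noteq> 0 \<longrightarrow> x \<bullet> (M *v x) > 0)}"

definition He :: "real^'k^'k \<Rightarrow> real^'k^'k" where
  "He M = M + transpose M"

text \<open>
  Block matrices are indexed by sum types, so that a block matrix over 'n + 'p + 'm
  has order CARD('n) + CARD('p) + CARD('m). In the type 'a^'c^'r, the rows are indexed by 'r
  and the columns by 'c.
\<close>

definition block_row :: "'a^'c1^'r \<Rightarrow> 'a^'c2^'r \<Rightarrow> 'a^('c1 + 'c2)^'r" where
  "block_row M N = (\<chi> i j. case j of Inl k \<Rightarrow> M $ i $ k | Inr k \<Rightarrow> N $ i $ k)"

definition block_col :: "'a^'c^'r1 \<Rightarrow> 'a^'c^'r2 \<Rightarrow> 'a^'c^('r1 + 'r2)" where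
  "block_col M N = (\<chi> i. case i of Inl k \<Rightarrow> M $ k | Inr k \<Rightarrow> N $ k)"

definition block3 ::
  "'a^'c1^'r1 \<Rightarrow> 'a^'c2^'r1 \<Rightarrow> 'a^'c3^'r1
   \<Rightarrow> 'a^'c1^'r2 \<Rightarrow> 'a^'c2^'r2 \<Rightarrow> 'a^'c3^'r2
   \<Rightarrow> 'a^'c1^'r3 \<Rightarrow> 'a^'c2^'r3 \<Rightarrow> 'a^'c3^'r3
   \<Rightarrow> 'a^('c1 + 'c2 + 'c3)^('r1 + 'r2 + 'r3)" where
  "block3 M11 M12 M13 M21 M22 M23 M31 M32 M33 =
     block_col (block_row M11 (block_row M12 M13))
       (block_col (block_row M21 (block_row M22 M23))
                  (block_row M31 (block_row M32 M33)))"

definition lmi_matrix ::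
  "real^'n^'n \<Rightarrow> real^'m1^'n \<Rightarrow> real^'m2^'n \<Rightarrow> real^'n^'p1 \<Rightarrow> real^'m1^'p1 \<Rightarrow> real^'m2^'p1
   \<Rightarrow> real \<Rightarrow> real^'n^'n \<Rightarrow> real^'n^'m2 \<Rightarrow> real^('n + 'p1 + 'm1)^('n + 'p1 + 'm1)" where
  "lmi_matrix A B1 B2 C1 D11 D12 \<gamma> X Y =
     - block3
         (He (A ** X + B2 ** Y))   (transpose (C1 ** X + D12 ** Y)) B1
         (C1 ** X + D12 ** Y)      (- (\<gamma> *\<^sub>R mat 1))               D11
         (transpose B1)            (transpose D11)                  (- (\<gamma> *\<^sub>R mat 1))"

text \<open>
  The LMI problem minimizes \<open>\<gamma>\<close> over all \<open>(\<gamma>, X, Y)\<close> with \<open>X\<close> and the LMI matrix positive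
  semidefinite. Strong feasibility asks for a triple satisfying both constraints strictly;
  it does not involve the objective.
\<close>

definition lmi_feasible_set ::
  "real^'n^'n \<Rightarrow> real^'m1^'n \<Rightarrow> real^'m2^'n \<Rightarrow> real^'n^'p1 \<Rightarrow> real^'m1^'p1 \<Rightarrow> real^'m2^'p1
   \<Rightarrow> (real \<times> (real^'n^'n) \<times> (real^'n^'m2)) set" where
  "lmi_feasible_set A B1 B2 C1 D11 D12 =
     {(\<gamma>, X, Y). lmi_matrix A B1 B2 C1 D11 D12 \<gamma> X Y \<in> psd_matrices \<and> X \<in> psd_matrices}"

definition lmi_strongly_feasible ::
  "real^'n^'n \<Rightarrow> real^'m1^'n \<Rightarrow> real^'m2^'n \<Rightarrow> real^'n^'p1 \<Rightarrow> real^'m1^'p1 \<Rightarrow> real^'m2^'p1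
   \<Rightarrow> bool" where
  "lmi_strongly_feasible A B1 B2 C1 D11 D12 \<longleftrightarrow>
     (\<exists>\<gamma> X Y. lmi_matrix A B1 B2 C1 D11 D12 \<gamma> X Y \<in> pd_matrices \<and> X \<in> pd_matrices)"

definition complex_matrix :: "real^'c^'r \<Rightarrow> complex^'c^'r" where
  "complex_matrix M = (\<chi> i j. complex_of_real (M $ i $ j))"

definition stabilizable :: "real^'n^'n \<Rightarrow> real^'m2^'n \<Rightarrow> bool" where
  "stabilizable A B2 \<longleftrightarrow>
     \<not> (\<exists>\<mu>::complex. Re \<mu> \<ge> 0 \<and>
          rank (block_row (complex_matrix A - mat \<mu>) (complex_matrix B2)) < CARD('n))"

text \<open>
  The control system x' = A x + B1 w + B2 u, z = C1 x + D11 w + D12 u is given by its matrices.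
\<close>

definition control_system_stabilizable ::
  "real^'n^'n \<Rightarrow> real^'m1^'n \<Rightarrow> real^'m2^'n \<Rightarrow> real^'n^'p1 \<Rightarrow> real^'m1^'p1 \<Rightarrow> real^'m2^'p1
   \<Rightarrow> bool" where
  "control_system_stabilizable A B1 B2 C1 D11 D12 \<longleftrightarrow> stabilizable A B2"

end

theory Submission
  imports Defs "HOL-Computational_Algebra.Fundamental_Theorem_Algebra"
begin

text \<open>
  For large \<open>\<gamma>\<close> the blocks other than \<open>He (A X + B2 Y)\<close> are harmless, so strong feasibility
  amounts to negative definiteness of \<open>He (A X + B2 Y)\<close> for some \<open>X\<close> positive definite and
  some \<open>Y\<close>. Testing this on a left eigenvector of \<open>A\<close> that violates the Hautus condition gives a
  contradiction. Conversely, if no such \<open>X\<close>, \<open>Y\<close> exist, a separating hyperplane yields a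
  nonzero positive semidefinite \<open>Z\<close> with \<open>B2\<^sup>T Z = 0\<close> and \<open>A\<^sup>T Z + Z A\<close> positive semidefinite;
  its range is invariant under \<open>A\<^sup>T\<close>, and any eigenvector of \<open>A\<^sup>T\<close> in the complexified range
  violates the Hautus condition.
\<close>

section \<open>Eigenvectors in invariant subspaces\<close>

text \<open>\<open>krylov_poly A v p\<close> is \<open>p(A) v\<close>.\<close>

definition krylov_poly :: "'a::field^'n^'n \<Rightarrow> 'a^'n \<Rightarrow> 'a poly \<Rightarrow> 'a^'n" where
  "krylov_poly A v p = fold_coeffs (\<lambda>c w. c *s v + A *v w) p 0"

lemma krylov_poly_0 [simp]: "krylov_poly A v 0 = 0"
  by (simp add: krylov_poly_def)

lemma krylov_poly_pCons [simp]:
  "krylov_poly A v (pCons c p) = c *s v + A *v krylov_poly A v p"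
  by (cases "p = 0 \<and> c = 0") (auto simp: krylov_poly_def)

lemma krylov_poly_add: "krylov_poly A v (p + q) = krylov_poly A v p + krylov_poly A v q"
  by (induction p q rule: poly_induct2)
     (simp_all add: vec.scale_left_distrib matrix_vector_right_distrib algebra_simps)

lemma krylov_poly_smult: "krylov_poly A v (smult c p) = c *s krylov_poly A v p"
  by (induction p) (simp_all add: vec.scale_right_distrib matrix_vector_mult_scaleR vec.scale)

lemma krylov_poly_monom: "krylov_poly A v (monom c i) = c *s (((*v) A) ^^ i) v"
  by (induction i) (simp_all add: monom_0 monom_Suc vec.scale)

lemma krylov_poly_sum: "krylov_poly A v (\<Sum>i\<in>I. f i) = (\<Sum>i\<in>I. krylov_poly A v (f i))"
  by (induction I rule: infinite_finite_induct) (simp_all add: krylov_poly_add)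

lemma krylov_poly_in_subspace:
  assumes "vec.subspace S" "v \<in> S" "\<And>x. x \<in> S \<Longrightarrow> A *v x \<in> S"
  shows "krylov_poly A v p \<in> S"
  by (induction p)
     (use assms in \<open>auto intro: vec.subspace_0 vec.subspace_add vec.subspace_scale\<close>)

text \<open>More vectors than the dimension are dependent. The family is indexed because iterates of
  a matrix on a vector may coincide, and a repetition would vanish in the image set; there the
  coefficients 1 and -1 at two equal members do the job.\<close>

lemma dependent_family:
  fixes w :: "nat \<Rightarrow> 'a::field^'n"
  shows "\<exists>c. (\<exists>i\<le>CARD('n). c i \<noteq> 0) \<and> (\<Sum>i\<le>CARD('n). c i *s w i) = 0"
proof (cases "inj_on w {..CARD('n)}")
  case True
  have "vec.dependent (w ` {..CARD('n)})"
  proof (rule ccontr)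
    assume "vec.independent (w ` {..CARD('n)})"
    then have "card (w ` {..CARD('n)}) \<le> vec.dim (UNIV :: ('a^'n) set)"
      by (intro vec.independent_card_le_dim) auto
    then show False
      using True by (simp add: card_image card_cart_basis)
  qed
  then obtain u where "\<exists>x\<in>w ` {..CARD('n)}. u x \<noteq> 0"
    and "(\<Sum>x\<in>w ` {..CARD('n)}. u x *s x) = 0"
    by (subst (asm) vec.dependent_finite) auto
  then show ?thesis
    using True by (intro exI[of _ "u \<circ> w"]) (auto simp: sum.reindex)
next
  case False
  then obtain i j where ij: "i \<le> CARD('n)" "j \<le> CARD('n)" "i \<noteq> j" "w i = w j"
    by (auto simp: inj_on_def)
  define c :: "nat \<Rightarrow> 'a" where "c k = of_bool (k = i) - of_bool (k = j)" for k
  have "(\<Sum>k\<le>CARD('n). c k *s w k)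
      = (\<Sum>k\<le>CARD('n). if k = i then w k else 0) - (\<Sum>k\<le>CARD('n). if k = j then w k else 0)"
    unfolding sum_subtractf[symmetric] c_def by (rule sum.cong) auto
  also have "\<dots> = 0"
    using ij by (simp add: sum.delta)
  finally show ?thesis
    using ij by (intro exI[of _ c]) (auto simp: c_def)
qed

text \<open>Take a nonzero polynomial \<open>p\<close> of least degree with
  \<open>p(A) v = 0\<close> and split off a root: \<open>p = (x - \<mu>) q\<close>. By minimality
  \<open>q(A) v\<close> is nonzero, \<open>A - \<mu>\<close> annihilates it, and it stays in
  \<open>S\<close> as a polynomial in \<open>A\<close> applied to \<open>v\<close>.\<close>

lemma invariant_subspace_eigenvector:
  fixes A :: "complex^'n^'n"
  assumes S: "vec.subspace S" "\<And>x. x \<in> S \<Longrightarrow> A *v x \<in> S" and v: "v \<in> S" "v \<noteq> 0"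
  shows "\<exists>\<mu> u. u \<in> S \<and> u \<noteq> 0 \<and> A *v u = \<mu> *s u"
proof -
  let ?P = "\<lambda>p. p \<noteq> 0 \<and> krylov_poly A v p = 0"
  obtain c i where c: "i \<le> CARD('n)" "c i \<noteq> 0"
    "(\<Sum>i\<le>CARD('n). c i *s (((*v) A) ^^ i) v) = 0"
    using dependent_family[of "\<lambda>i. (((*v) A) ^^ i) v"] by auto
  have "coeff (\<Sum>i\<le>CARD('n). monom (c i) i) i = c i"
    using c(1) by (simp add: coeff_sum)
  then have "?P (\<Sum>i\<le>CARD('n). monom (c i) i)"
    using c by (auto simp: krylov_poly_sum krylov_poly_monom)
  then obtain p where p: "?P p" and p_min: "\<And>q. ?P q \<Longrightarrow> degree p \<le> degree q"
    using ex_has_least_nat[of ?P _ degree] by blast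
  have "degree p \<noteq> 0"
  proof
    assume "degree p = 0"
    then obtain a where "p = [:a:]"
      by (rule degree_eq_zeroE)
    then show False
      using p v(2) by (simp add: vec.scale_eq_0_iff)
  qed
  then have "\<not> constant (poly p)"
    by (simp add: constant_degree)
  then obtain \<mu> where "poly p \<mu> = 0"
    using fundamental_theorem_of_algebra by blast
  then obtain q where q: "p = [:-\<mu>, 1:] * q"
    by (auto simp: poly_eq_0_iff_dvd)
  let ?u = "krylov_poly A v q"
  have "q \<noteq> 0"
    using p q by auto
  then have "degree q < degree p"
    unfolding q by (subst degree_mult_eq) auto
  then have "?u \<noteq> 0"
    using p_min[of q] \<open>q \<noteq> 0\<close> by auto
  moreover have "A *v ?u = \<mu> *s ?u"
  proof -
    \<comment> \<open>This writes the product \<open>(x - \<mu>) q\<close> in the two forms that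
      \<open>krylov_poly\<close> can evaluate, scaling and shift.\<close>
    have "p = smult (-\<mu>) q + pCons 0 q"
      by (simp add: q)
    then have "0 = (-\<mu>) *s ?u + A *v ?u"
      using p by (metis krylov_poly_add krylov_poly_smult krylov_poly_pCons
          vec.scale_zero_left add_0)
    then show ?thesis
      by (simp add: vec.scale_minus_left)
  qed
  moreover have "?u \<in> S"
    by (rule krylov_poly_in_subspace) (use S v in auto)
  ultimately show ?thesis by blast
qed

section \<open>The Hautus condition in terms of real left vectors\<close>

text \<open>A left null vector is a linear relation among the rows. Since \<open>rows M\<close> is a
  set, equal rows collapse in it, so both directions must keep track of whether the row map is
  injective.\<close>

lemma rank_less_rows_iff:
  fixes M :: "'a::field^'c^'r"
  shows "rank M < CARD('r) \<longleftrightarrow> (\<exists>u. u \<noteq> 0 \<and> u v* M = 0)"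
proof -
  have rows: "rows M = range (\<lambda>i. row i M)"
    by (auto simp: rows_def)
  have comb: "u v* M = (\<Sum>i\<in>UNIV. (u $ i) *s row i M)" for u
    by (simp add: vec_eq_iff vector_matrix_mult_def row_def mult.commute)
  have le: "card (rows M) \<le> CARD('r)"
    unfolding rows by (rule card_image_le) simp
  show ?thesis
  proof
    assume less: "rank M < CARD('r)"
    show "\<exists>u. u \<noteq> 0 \<and> u v* M = 0"
    proof (cases "inj (\<lambda>i. row i M)")
      case True
      have "vec.dependent (rows M)"
        using less True vec.dim_eq_card_independent[of "rows M"]
        by (auto simp: row_rank_def_gen rows card_image)
      then obtain c where c: "\<exists>x\<in>rows M. c x \<noteq> 0" "(\<Sum>x\<in>rows M. c x *s x) = 0"
        by (subst (asm) vec.dependent_finite) (auto simp: rows)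
      have "(\<chi> i. c (row i M)) v* M = 0"
        using c(2) True by (simp add: comb rows sum.reindex)
      moreover have "(\<chi> i. c (row i M)) \<noteq> 0"
        using c(1) by (auto simp: vec_eq_iff rows)
      ultimately show ?thesis by blast
    next
      case False
      then obtain i j where ij: "i \<noteq> j" "row i M = row j M"
        by (auto simp: inj_def)
      \<comment> \<open>Two equal rows are cancelled by the difference of the corresponding unit
        vectors.\<close>
      have "(axis i 1 - axis j 1) v* M = (\<Sum>k\<in>UNIV. if k = i then row k M else 0)
          - (\<Sum>k\<in>UNIV. if k = j then row k M else 0)"
        unfolding comb sum_subtractf[symmetric] by (rule sum.cong) (auto simp: axis_def)
      then have "(axis i 1 - axis j 1) v* M = row i M - row j M"
        by simp
      moreover have "axis i 1 - axis j (1::'a) \<noteq> 0"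
        using ij(1) by (auto simp: vec_eq_iff axis_def)
      ultimately show ?thesis
        using ij(2) by (intro exI[of _ "axis i 1 - axis j 1"]) simp
    qed
  next
    assume "\<exists>u. u \<noteq> 0 \<and> u v* M = 0"
    then obtain u where u: "u \<noteq> 0" "u v* M = 0" by blast
    show "rank M < CARD('r)"
    proof (rule ccontr)
      assume "\<not> rank M < CARD('r)"
      then have dim: "CARD('r) \<le> vec.dim (rows M)"
        by (simp add: row_rank_def_gen)
      moreover have fin: "finite (rows M)"
        by (simp add: rows)
      moreover have "vec.dim (rows M) \<le> card (rows M)"
        using fin by (intro vec.dim_le_card) (auto intro: vec.span_base)
      \<comment> \<open>Full rank squeezes both cardinality and dimension of \<open>rows M\<close>
        to the number of row indices, so the rows are distinct and independent.\<close>
      ultimately have card: "card (rows M) = CARD('r)" "vec.dim (rows M) = card (rows M)"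
        using le by auto
      have inj: "inj (\<lambda>i. row i M)"
        using card(1) by (intro eq_card_imp_inj_on) (auto simp: rows)
      have "vec.independent (rows M)"
        using card(2) fin by (intro vec.card_le_dim_spanning[of _ "rows M"]) (auto intro: vec.span_base)
      moreover have "(\<Sum>x\<in>rows M. (u $ inv (\<lambda>i. row i M) x) *s x) = 0"
        using u(2) inv_f_f[OF inj] by (simp add: comb rows sum.reindex[OF inj])
      ultimately have "\<forall>x\<in>rows M. u $ inv (\<lambda>i. row i M) x = 0"
        using fin vec.independentD[of "rows M" "rows M" "\<lambda>x. u $ inv (\<lambda>i. row i M) x"] by blast
      then have "u $ i = 0" for i
        using inv_f_f[OF inj, of i] rows by (metis rangeI)
      then show False
        using u(1) by (simp add: vec_eq_iff)
    qed
  qed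
qed

lemma vector_mult_block_row_eq_0_iff:
  "u v* block_row M N = 0 \<longleftrightarrow> u v* M = 0 \<and> u v* N = 0"
proof -
  have "u v* block_row M N
      = (\<chi> j. case j of Inl k \<Rightarrow> (u v* M) $ k | Inr k \<Rightarrow> (u v* N) $ k)"
    by (auto simp: vec_eq_iff vector_matrix_mult_def block_row_def split: sum.split)
  then show ?thesis
    by (auto simp: vec_eq_iff split: sum.splits)
qed

text \<open>Real and imaginary parts of a left eigenvector \<open>u = p + i q\<close> for
  \<open>\<mu> = \<sigma> + i \<tau>\<close> that annihilates \<open>B\<close>. This lets both
  directions of the theorem work with real quadratic forms.\<close>

lemma not_stabilizable_iff:
  "\<not> stabilizable A B \<longleftrightarrow>
    (\<exists>\<sigma> \<tau> p q. \<sigma> \<ge> 0 \<and> (p \<noteq> 0 \<or> q \<noteq> 0) \<and>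
       p v* A = \<sigma> *\<^sub>R p - \<tau> *\<^sub>R q \<and> q v* A = \<tau> *\<^sub>R p + \<sigma> *\<^sub>R q \<and> p v* B = 0 \<and> q v* B = 0)"
  (is "_ = (\<exists>\<sigma> \<tau> p q. ?P \<sigma> \<tau> p q)")
proof -
  have eigen: "u v* (complex_matrix A - mat \<mu>) = 0 \<longleftrightarrow>
      (\<forall>j. (\<Sum>i\<in>UNIV. complex_of_real (A $ i $ j) * u $ i) = \<mu> * u $ j)" for \<mu> u
  proof -
    have "(u v* (complex_matrix A - mat \<mu>)) $ j
        = (\<Sum>i\<in>UNIV. complex_of_real (A $ i $ j) * u $ i) - (\<Sum>i\<in>UNIV. if i = j then \<mu> * u $ i else 0)" for j
      unfolding sum_subtractf[symmetric]
      by (simp add: vector_matrix_mult_def complex_matrix_def mat_def)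
         (rule sum.cong, auto simp: algebra_simps)
    then show ?thesis
      by (simp add: vec_eq_iff)
  qed
  have pq: "u \<noteq> 0 \<and> u v* (complex_matrix A - mat \<mu>) = 0 \<and> u v* complex_matrix B = 0 \<and> Re \<mu> \<ge> 0
      \<longleftrightarrow> ?P (Re \<mu>) (Im \<mu>) (\<chi> i. Re (u $ i)) (\<chi> i. Im (u $ i))" for \<mu> u
    unfolding eigen
    by (auto simp: vec_eq_iff vector_matrix_mult_def complex_matrix_def complex_eq_iff algebra_simps)
  have "\<not> stabilizable A B \<longleftrightarrow>
      (\<exists>\<mu> u. u \<noteq> 0 \<and> u v* (complex_matrix A - mat \<mu>) = 0 \<and> u v* complex_matrix B = 0 \<and> Re \<mu> \<ge> 0)"
    unfolding stabilizable_def rank_less_rows_iff vector_mult_block_row_eq_0_iff by blast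
  also have "\<dots> \<longleftrightarrow> (\<exists>\<sigma> \<tau> p q. ?P \<sigma> \<tau> p q)"
  proof
    assume "\<exists>\<sigma> \<tau> p q. ?P \<sigma> \<tau> p q"
    then obtain \<sigma> \<tau> p q where *: "?P \<sigma> \<tau> p q" by blast
    show "\<exists>\<mu> u. u \<noteq> 0 \<and> u v* (complex_matrix A - mat \<mu>) = 0 \<and> u v* complex_matrix B = 0 \<and> Re \<mu> \<ge> 0"
      unfolding pq
      by (rule exI[of _ "Complex \<sigma> \<tau>"], rule exI[of _ "\<chi> i. Complex (p $ i) (q $ i)"])
         (use * in simp)
  qed (unfold pq, blast)
  finally show ?thesis .
qed


section \<open>Block vectors and the quadratic form of the LMI matrix\<close>

definition vfst :: "'a^('m::finite + 'n::finite) \<Rightarrow> 'a^'m" where "vfst x = (\<chi> i. x $ Inl i)"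

definition vsnd :: "'a^('m::finite + 'n::finite) \<Rightarrow> 'a^'n" where "vsnd x = (\<chi> i. x $ Inr i)"

lemma sum_UNIV_sum:
  fixes f :: "'m::finite + 'n::finite \<Rightarrow> 'b::comm_monoid_add"
  shows "(\<Sum>i\<in>UNIV. f i) = (\<Sum>i\<in>UNIV. f (Inl i)) + (\<Sum>i\<in>UNIV. f (Inr i))"
  unfolding UNIV_Plus_UNIV[symmetric] by (subst sum.Plus) simp_all

lemma inner_sum_vec:
  fixes x y :: "real^('m::finite + 'n::finite)"
  shows "x \<bullet> y = vfst x \<bullet> vfst y + vsnd x \<bullet> vsnd y"
  by (simp add: inner_vec_def sum_UNIV_sum vfst_def vsnd_def)

lemma block_row_mult_vec: "block_row M N *v x = M *v vfst x + N *v vsnd x"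
  by (simp add: vec_eq_iff matrix_vector_mult_def sum_UNIV_sum block_row_def vfst_def vsnd_def)

lemma vfst_block_col_mult [simp]: "vfst (block_col M N *v x) = M *v x"
  and vsnd_block_col_mult [simp]: "vsnd (block_col M N *v x) = N *v x"
  by (simp_all add: vec_eq_iff matrix_vector_mult_def block_col_def vfst_def vsnd_def)

lemma inner_transpose: "x \<bullet> (transpose M *v y) = y \<bullet> (M *v (x :: real^'n))"
  by (metis dot_lmul_matrix inner_commute transpose_matrix_vector)

lemma inner_He: "x \<bullet> (He M *v x) = 2 * (x \<bullet> (M *v x))"
  using inner_transpose[of x M x]
  by (simp add: He_def matrix_vector_mult_add_rdistrib inner_add_right)

lemma uminus_matrix_vector_mult:
  fixes M :: "real^'n^'m"
  shows "(- M) *v x = - (M *v x)"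
  by (metis diff_0 matrix_vector_mult_0 matrix_vector_mult_diff_rdistrib)

text \<open>Each off-diagonal block occurs together with its transpose, hence the factors 2. The
  expansion reduces definiteness to estimates in the norms of the three components of
  \<open>x\<close>.\<close>

lemma lmi_matrix_inner:
  "x \<bullet> (lmi_matrix A B1 B2 C1 D11 D12 \<gamma> X Y *v x) =
     - 2 * (vfst x \<bullet> ((A ** X + B2 ** Y) *v vfst x))
     - 2 * (vfst (vsnd x) \<bullet> ((C1 ** X + D12 ** Y) *v vfst x))
     - 2 * (vfst x \<bullet> (B1 *v vsnd (vsnd x)))
     - 2 * (vfst (vsnd x) \<bullet> (D11 *v vsnd (vsnd x)))
     + \<gamma> * (norm (vfst (vsnd x)))\<^sup>2 + \<gamma> * (norm (vsnd (vsnd x)))\<^sup>2"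
  unfolding lmi_matrix_def block3_def uminus_matrix_vector_mult
  by (simp del: transpose_matrix_vector
        add: inner_sum_vec[of x] inner_sum_vec[of "vsnd x"] inner_He block_row_mult_vec inner_transpose
          inner_add_right inner_diff_right uminus_matrix_vector_mult inner_commute algebra_simps flip: scaleR_matrix_vector_assoc power2_norm_eq_inner)

lemma block_row_nth [simp]: "block_row M N $ i $ Inl j = M $ i $ j" "block_row M N $ i $ Inr k = N $ i $ k"
  by (simp_all add: block_row_def)

lemma block_col_nth [simp]: "block_col M N $ Inl i = M $ i" "block_col M N $ Inr k = N $ k"
  by (simp_all add: block_col_def)

lemma transpose_lmi_matrix:
  "transpose (lmi_matrix A B1 B2 C1 D11 D12 \<gamma> X Y) = lmi_matrix A B1 B2 C1 D11 D12 \<gamma> X Y"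
  unfolding vec_eq_iff split_sum_all
  by (simp add: lmi_matrix_def block3_def He_def transpose_def mat_def)

section \<open>Reduction of strong feasibility to the upper left block\<close>

text \<open>The constant is the minimum of the quadratic form on the compact unit sphere;
  homogeneity of degree 2 extends the bound to all vectors.\<close>

lemma pos_def_lower_bound:
  fixes M :: "real^'n^'n"
  assumes "\<And>x. x \<noteq> 0 \<Longrightarrow> 0 < x \<bullet> (M *v x)"
  obtains c where "c > 0" "\<And>x. c * (norm x)\<^sup>2 \<le> x \<bullet> (M *v x)"
proof -
  have "continuous_on (sphere 0 1) (\<lambda>x. x \<bullet> (M *v x))"
    by (intro continuous_intros linear_continuous_on matrix_vector_mul_bounded_linear)
  then obtain y where y: "y \<in> sphere 0 1" "\<And>x. x \<in> sphere 0 1 \<Longrightarrow> y \<bullet> (M *v y) \<le> x \<bullet> (M *v x)"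
    using continuous_attains_inf[of "sphere (0::real^'n) 1" "\<lambda>x. x \<bullet> (M *v x)"] by auto
  have "(y \<bullet> (M *v y)) * (norm x)\<^sup>2 \<le> x \<bullet> (M *v x)" for x
  proof (cases "x = 0")
    case False
    have "y \<bullet> (M *v y) \<le> (x /\<^sub>R norm x) \<bullet> (M *v (x /\<^sub>R norm x))"
      using False by (intro y(2)) simp
    also have "\<dots> = (x \<bullet> (M *v x)) / (norm x)\<^sup>2"
      using False by (simp add: matrix_vector_mult_scaleR power2_eq_square field_simps)
    finally show ?thesis
      using False by (simp add: field_simps)
  qed simp
  moreover have "y \<bullet> (M *v y) > 0"
    using y(1) by (intro assms) auto
  ultimately show ?thesis
    by (intro that)
qed

lemma inner_mult_vec_le:
  fixes M :: "real^'n^'m"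
  shows "\<exists>K>0. \<forall>x y. x \<bullet> (M *v y) \<le> K * norm x * norm y"
proof -
  obtain K where K: "K > 0" "\<And>y. norm (M *v y) \<le> norm y * K"
    using bounded_linear.pos_bounded[OF matrix_vector_mul_bounded_linear[of M]] by auto
  have "x \<bullet> (M *v y) \<le> K * norm x * norm y" for x y
  proof -
    have "x \<bullet> (M *v y) \<le> norm x * norm (M *v y)"
      by (rule norm_cauchy_schwarz)
    also have "\<dots> \<le> norm x * (norm y * K)"
      by (intro mult_left_mono K) simp
    finally show ?thesis by (simp add: ac_simps)
  qed
  with K(1) show ?thesis by blast
qed

text \<open>Forward, test the LMI matrix on vectors supported in the first block. Backward, a large
  \<open>\<gamma>\<close> absorbs all cross terms, at the expense of half of the definiteness of the
  first block.\<close>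

lemma lmi_strongly_feasible_iff:
  fixes A :: "real^'n^'n" and B1 :: "real^'d^'n" and D11 :: "real^'d^'e"
  shows "lmi_strongly_feasible A B1 B2 C1 D11 D12 \<longleftrightarrow>
    (\<exists>X Y. X \<in> pd_matrices \<and> (\<forall>x. x \<noteq> 0 \<longrightarrow> x \<bullet> ((A ** X + B2 ** Y) *v x) < 0))"
proof
  assume "lmi_strongly_feasible A B1 B2 C1 D11 D12"
  then obtain \<gamma> X Y where L: "lmi_matrix A B1 B2 C1 D11 D12 \<gamma> X Y \<in> pd_matrices"
    and X: "X \<in> pd_matrices"
    by (auto simp: lmi_strongly_feasible_def)
  have "x \<bullet> ((A ** X + B2 ** Y) *v x) < 0" if "x \<noteq> 0" for x
  proof -
    define w where "w = (\<chi> i. case i of Inl k \<Rightarrow> x $ k | Inr k \<Rightarrow> (0 :: real^('e + 'd)) $ k)"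
    have w: "vfst w = x" "vsnd w = 0"
      by (simp_all add: vec_eq_iff vfst_def vsnd_def w_def)
    have zero: "vfst (0 :: real^('i::finite + 'j::finite)) = 0" "vsnd (0 :: real^('i + 'j)) = 0"
      by (simp_all add: vec_eq_iff vfst_def vsnd_def)
    have "w \<noteq> 0"
      using that w(1) zero by metis
    then have "0 < w \<bullet> (lmi_matrix A B1 B2 C1 D11 D12 \<gamma> X Y *v w)"
      using L by (simp add: pd_matrices_def)
    then show ?thesis
      unfolding lmi_matrix_inner w by (simp add: zero)
  qed
  with X show "\<exists>X Y. X \<in> pd_matrices \<and> (\<forall>x. x \<noteq> 0 \<longrightarrow> x \<bullet> ((A ** X + B2 ** Y) *v x) < 0)"
    by blast
next
  assume "\<exists>X Y. X \<in> pd_matrices \<and> (\<forall>x. x \<noteq> 0 \<longrightarrow> x \<bullet> ((A ** X + B2 ** Y) *v x) < 0)"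
  then obtain X Y where X: "X \<in> pd_matrices"
    and neg: "\<And>x. x \<noteq> 0 \<Longrightarrow> x \<bullet> ((A ** X + B2 ** Y) *v x) < 0"
    by blast
  obtain c where c: "c > 0" "\<And>x. c * (norm x)\<^sup>2 \<le> x \<bullet> (- (A ** X + B2 ** Y) *v x)"
    using pos_def_lower_bound[of "- (A ** X + B2 ** Y)"] neg unfolding uminus_matrix_vector_mult by auto
  obtain K1 K2 K3 where K: "K1 > 0" "K2 > 0" "K3 > 0"
    and K1: "\<And>x y. x \<bullet> ((C1 ** X + D12 ** Y) *v y) \<le> K1 * norm x * norm y"
    and K2: "\<And>x y. x \<bullet> (B1 *v y) \<le> K2 * norm x * norm y"
    and K3: "\<And>x y. x \<bullet> (D11 *v y) \<le> K3 * norm x * norm y"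
    using inner_mult_vec_le by metis
  \<comment> \<open>The first block contributes \<open>2 * c\<close> times the squared norm. The
    cross terms with \<open>K1\<close> and \<open>K2\<close> cost \<open>c / 2\<close> each there,
    plus the two fractions in the other blocks; \<open>K3\<close> pays for the \<open>D11\<close>
    term and the final 1 leaves a strict margin.\<close>
  define \<gamma> where "\<gamma> = 2 * K1\<^sup>2 / c + 2 * K2\<^sup>2 / c + K3 + 1"
  have "0 < x \<bullet> (lmi_matrix A B1 B2 C1 D11 D12 \<gamma> X Y *v x)" if "x \<noteq> 0" for x
  proof -
    let ?r = "norm (vfst x)" and ?s = "norm (vfst (vsnd x))" and ?t = "norm (vsnd (vsnd x))"
    have "?r \<noteq> 0 \<or> ?s \<noteq> 0 \<or> ?t \<noteq> 0"
    proof (rule ccontr)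
      assume "\<not> ?thesis"
      then have "x $ i = 0" for i
        by (cases i rule: sum.exhaust; cases "projr i" rule: sum.exhaust)
           (auto simp: vec_eq_iff vfst_def vsnd_def)
      then show False
        using that by (simp add: vec_eq_iff)
    qed
    have young: "2 * K * a * b \<le> c / 2 * a\<^sup>2 + 2 * K\<^sup>2 / c * b\<^sup>2" for K a b :: real
    proof -
      have "0 \<le> c / 2 * (a - 2 * K / c * b)\<^sup>2"
        using c(1) by simp
      also have "\<dots> = c / 2 * a\<^sup>2 + 2 * K\<^sup>2 / c * b\<^sup>2 - 2 * K * a * b"
        using c(1) by (simp add: power2_eq_square field_simps)
      finally show ?thesis by simp
    qed
    have "2 * ?s * ?t \<le> ?s\<^sup>2 + ?t\<^sup>2"
      by (rule sum_squares_bound)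
    then have "K3 * (2 * ?s * ?t) \<le> K3 * (?s\<^sup>2 + ?t\<^sup>2)"
      using K(3) by (intro mult_left_mono) auto
    then have st: "2 * K3 * ?s * ?t \<le> K3 * ?s\<^sup>2 + K3 * ?t\<^sup>2"
      by (simp add: algebra_simps)
    have nn: "0 \<le> 2 * K1\<^sup>2 / c * ?t\<^sup>2" "0 \<le> 2 * K2\<^sup>2 / c * ?s\<^sup>2"
      using c(1) by simp_all
    have "0 < c * ?r\<^sup>2 + ?s\<^sup>2 + ?t\<^sup>2"
      using \<open>?r \<noteq> 0 \<or> ?s \<noteq> 0 \<or> ?t \<noteq> 0\<close> c(1)
      by (smt (verit) mult_pos_pos zero_less_power2 zero_le_power2 mult_nonneg_nonneg)
    also have "\<dots> \<le> 2 * (c * ?r\<^sup>2) - 2 * (K1 * ?s * ?r) - 2 * (K2 * ?r * ?t) - 2 * (K3 * ?s * ?t)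
        + \<gamma> * ?s\<^sup>2 + \<gamma> * ?t\<^sup>2"
      using young[of K1 ?r ?s] young[of K2 ?r ?t] st nn
      unfolding \<gamma>_def by (simp add: algebra_simps)
    also have "\<dots> \<le> x \<bullet> (lmi_matrix A B1 B2 C1 D11 D12 \<gamma> X Y *v x)"
      unfolding lmi_matrix_inner
      using c(2)[of "vfst x"] K1[of "vfst (vsnd x)" "vfst x"] K2[of "vfst x" "vsnd (vsnd x)"]
        K3[of "vfst (vsnd x)" "vsnd (vsnd x)"]
      unfolding uminus_matrix_vector_mult by simp
    finally show ?thesis .
  qed
  then have "lmi_matrix A B1 B2 C1 D11 D12 \<gamma> X Y \<in> pd_matrices"
    by (simp add: pd_matrices_def transpose_lmi_matrix)
  with X show "lmi_strongly_feasible A B1 B2 C1 D11 D12"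
    unfolding lmi_strongly_feasible_def by blast
qed

section \<open>Separation in the space of matrices\<close>

definition outer_product :: "real^'m \<Rightarrow> real^'n \<Rightarrow> real^'n^'m" where
  "outer_product u v = (\<chi> i j. u $ i * v $ j)"

text \<open>The inner product of matrices is the entrywise one, so pairing with rank-one matrices
  turns a separating functional \<open>Z\<close> into statements about its bilinear form.\<close>

lemma inner_outer_product: "Z \<bullet> outer_product u v = u \<bullet> (Z *v v)"
  by (simp add: inner_vec_def outer_product_def matrix_vector_mult_def sum_distrib_left ac_simps)

lemma outer_product_mult_vec: "outer_product u v *v w = (v \<bullet> w) *\<^sub>R u"
  by (simp add: vec_eq_iff inner_vec_def outer_product_def matrix_vector_mult_def
      sum_distrib_left sum_distrib_right ac_simps)

lemma mult_outer_product: "A ** outer_product u v = outer_product (A *v u) v"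
  by (simp add: vec_eq_iff outer_product_def matrix_vector_mult_def matrix_matrix_mult_def
      sum_distrib_left sum_distrib_right ac_simps)

lemma inner_matrix_mult:
  fixes Z :: "real^'m^'n"
  shows "Z \<bullet> (B ** Y) = (transpose B ** Z) \<bullet> Y"
proof -
  have "Z \<bullet> (B ** Y) = (\<Sum>i\<in>UNIV. \<Sum>j\<in>UNIV. \<Sum>k\<in>UNIV. Z $ i $ j * (B $ i $ k * Y $ k $ j))"
    by (simp add: inner_vec_def matrix_matrix_mult_def sum_distrib_left)
  also have "\<dots> = (\<Sum>k\<in>UNIV. \<Sum>j\<in>UNIV. \<Sum>i\<in>UNIV. Z $ i $ j * (B $ i $ k * Y $ k $ j))"
    by (subst (2) sum.swap, subst sum.swap, subst (2) sum.swap) (rule refl)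
  also have "\<dots> = (transpose B ** Z) \<bullet> Y"
    by (simp add: inner_vec_def matrix_matrix_mult_def transpose_def sum_distrib_left ac_simps)
  finally show ?thesis .
qed

text \<open>The limit \<open>e\<close> to 0, made explicit: the chosen \<open>e\<close> would give
  \<open>a + e * b \<le> a / 2 < 0\<close>.\<close>

lemma nonneg_if_nonneg_perturbation:
  fixes a b :: real
  assumes "\<And>e. e > 0 \<Longrightarrow> 0 \<le> a + e * b"
  shows "0 \<le> a"
proof (rule ccontr)
  assume "\<not> 0 \<le> a"
  define e where "e = - a / (2 * (\<bar>b\<bar> + 1))"
  have "e > 0"
    unfolding e_def using \<open>\<not> 0 \<le> a\<close> by (intro divide_pos_pos) auto
  then have "0 \<le> a + e * b" "e * b \<le> e * (\<bar>b\<bar> + 1)"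
    by (auto intro: assms)
  moreover have "e * (\<bar>b\<bar> + 1) = - a / 2"
    by (simp add: e_def field_simps)
  ultimately show False
    using \<open>\<not> 0 \<le> a\<close> by simp
qed

text \<open>Infeasibility says that the convex set of all \<open>A ** X + B ** Y + P\<close>, with
  \<open>X\<close> and \<open>P\<close> positive, misses 0. The normal \<open>Z\<close> of a
  separating hyperplane is then tested on each of \<open>X\<close>, \<open>Y\<close> and
  \<open>P\<close> alone.\<close>

lemma separating_matrix:
  fixes A :: "real^'n^'n" and B :: "real^'m^'n"
  assumes infeasible: "\<nexists>X Y. X \<in> pd_matrices \<and> (\<forall>x. x \<noteq> 0 \<longrightarrow> x \<bullet> ((A ** X + B ** Y) *v x) < 0)"
  obtains Z where "Z \<noteq> 0" "transpose Z = Z" "\<And>x. 0 \<le> x \<bullet> (Z *v x)" "transpose B ** Z = 0"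
    "\<And>x. 0 \<le> (A *v x) \<bullet> (Z *v x)"
proof -
  define Pos where "Pos = {P :: real^'n^'n. \<forall>x. x \<noteq> 0 \<longrightarrow> 0 < x \<bullet> (P *v x)}"
  define S where "S = {A ** X + B ** Y + P |X Y P. X \<in> pd_matrices \<and> P \<in> Pos}"
  have pos_comb: "0 < x \<bullet> ((u *\<^sub>R P + v *\<^sub>R Q) *v x)"
    if "0 \<le> u" "0 \<le> v" "u + v = 1" "0 < x \<bullet> (P *v x)" "0 < x \<bullet> (Q *v x)"
    for u v x and P Q :: "real^'n^'n"
  proof -
    have "x \<bullet> ((u *\<^sub>R P + v *\<^sub>R Q) *v x) = u * (x \<bullet> (P *v x)) + v * (x \<bullet> (Q *v x))"
      by (simp add: matrix_vector_mult_add_rdistrib inner_add_right flip: scaleR_matrix_vector_assoc)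
    moreover have "0 < \<dots>"
      using that by (cases "u = 0") (auto intro: add_pos_nonneg)
    ultimately show ?thesis by simp
  qed
  have "convex S"
  proof (rule convexI)
    fix M N and u v :: real
    assume "M \<in> S" "N \<in> S" and uv: "0 \<le> u" "0 \<le> v" "u + v = 1"
    then obtain X Y P X' Y' P' where M: "M = A ** X + B ** Y + P" "X \<in> pd_matrices" "P \<in> Pos"
      and N: "N = A ** X' + B ** Y' + P'" "X' \<in> pd_matrices" "P' \<in> Pos"
      by (auto simp: S_def)
    have "u *\<^sub>R M + v *\<^sub>R N
        = A ** (u *\<^sub>R X + v *\<^sub>R X') + B ** (u *\<^sub>R Y + v *\<^sub>R Y') + (u *\<^sub>R P + v *\<^sub>R P')"
      unfolding M(1) N(1)
      by (simp add: matrix_add_ldistrib scaleR_add_right matrix_scalar_ac flip: scalar_matrix_assoc)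
    moreover have "u *\<^sub>R X + v *\<^sub>R X' \<in> pd_matrices"
      using M(2) N(2) uv by (auto simp: pd_matrices_def pos_comb transpose_def vec_eq_iff)
    moreover have "u *\<^sub>R P + v *\<^sub>R P' \<in> Pos"
      using M(3) N(3) uv by (auto simp: Pos_def pos_comb)
    ultimately show "u *\<^sub>R M + v *\<^sub>R N \<in> S"
      unfolding S_def by blast
  qed
  moreover have "0 \<notin> S"
  proof
    assume "0 \<in> S"
    then obtain X Y P where *: "A ** X + B ** Y + P = 0" "X \<in> pd_matrices" "P \<in> Pos"
      unfolding S_def by fastforce
    have "x \<bullet> ((A ** X + B ** Y) *v x) < 0" if "x \<noteq> 0" for x
    proof -
      have "x \<bullet> ((A ** X + B ** Y) *v x) + x \<bullet> (P *v x) = 0"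
        using *(1) by (simp flip: inner_add_right matrix_vector_mult_add_rdistrib)
      moreover have "0 < x \<bullet> (P *v x)"
        using *(3) that by (simp add: Pos_def)
      ultimately show ?thesis by linarith
    qed
    with *(2) infeasible show False by blast
  qed
  ultimately obtain Z where Z: "Z \<noteq> 0" "\<And>M. M \<in> S \<Longrightarrow> 0 \<le> Z \<bullet> M"
    using separating_hyperplane_set_0[of S] by blast
  have pos_perturb: "P + e *\<^sub>R mat 1 \<in> Pos" if "\<And>x. 0 \<le> x \<bullet> (P *v x)" "e > 0" for P and e :: real
    using that
    by (auto simp: Pos_def matrix_vector_mult_add_rdistrib inner_add_right
        simp flip: scaleR_matrix_vector_assoc intro: add_nonneg_pos)
  \<comment> \<open>Shifting \<open>X\<close> and \<open>P\<close> by a small multiple of the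
    identity makes them strictly positive; letting the shift tend to 0 extends the inequality to
    semidefinite ones, including 0.\<close>
  have closure: "0 \<le> Z \<bullet> (A ** X + B ** Y + P)"
    if "\<And>x. 0 \<le> x \<bullet> (X *v x)" "transpose X = X" "\<And>x. 0 \<le> x \<bullet> (P *v x)" for X Y P
  proof (rule nonneg_if_nonneg_perturbation)
    fix e :: real assume e: "e > 0"
    have "X + e *\<^sub>R mat 1 \<in> pd_matrices"
      using pos_perturb[OF that(1) e] that(2)
      by (auto simp: pd_matrices_def Pos_def transpose_def vec_eq_iff mat_def)
    moreover have "P + e *\<^sub>R mat 1 \<in> Pos"
      by (rule pos_perturb) fact+
    ultimately have "0 \<le> Z \<bullet> (A ** (X + e *\<^sub>R mat 1) + B ** Y + (P + e *\<^sub>R mat 1))"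
      by (intro Z(2)) (auto simp: S_def)
    also have "\<dots> = Z \<bullet> (A ** X + B ** Y + P) + e * (Z \<bullet> (A + mat 1))"
      by (simp add: matrix_add_ldistrib inner_add_right matrix_scalar_ac algebra_simps flip: scalar_matrix_assoc)
    finally show "0 \<le> Z \<bullet> (A ** X + B ** Y + P) + e * (Z \<bullet> (A + mat 1))" .
  qed
  have outer: "0 \<le> x \<bullet> (outer_product v v *v x)" "transpose (outer_product v v) = outer_product v v"
    for v x :: "real^'n"
    by (simp add: outer_product_mult_vec inner_commute)
       (simp add: outer_product_def transpose_def vec_eq_iff mult.commute)
  have zero: "transpose 0 = (0 :: real^'n^'n)"
    by (simp add: transpose_def vec_eq_iff)
  show ?thesis
  proof
    show "Z \<noteq> 0" by fact
    \<comment> \<open>The matrix \<open>transpose Z - Z\<close> is skew, so its quadratic form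
      vanishes. Pairing it with \<open>Z\<close> bounds its squared norm above by 0, because
      \<open>Z\<close> and its transpose have equal norm.\<close>
    have "0 \<le> x \<bullet> ((transpose Z - Z) *v x)" for x
      using inner_transpose[of x Z x]
      by (simp add: matrix_vector_mult_diff_rdistrib inner_diff_right)
    then have "0 \<le> Z \<bullet> (transpose Z - Z)"
      using closure[of 0 "transpose Z - Z" 0] zero by simp
    moreover have "transpose Z \<bullet> transpose Z = Z \<bullet> Z"
      unfolding inner_vec_def transpose_def by (simp, rule sum.swap)
    ultimately have "(transpose Z - Z) \<bullet> (transpose Z - Z) = 0"
      using inner_ge_zero[of "transpose Z - Z"]
      by (simp add: inner_diff_right inner_diff_left inner_commute)
    then show "transpose Z = Z"
      by simp
    show "0 \<le> x \<bullet> (Z *v x)" for x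
      using closure[of 0 "outer_product x x" 0] zero outer by (simp add: inner_outer_product)
    show "transpose B ** Z = 0"
    proof -
      \<comment> \<open>As \<open>Y\<close> is unrestricted, it can be taken as
        \<open>- (transpose B ** Z)\<close>, whose pairing is minus a squared norm.\<close>
      have "0 \<le> Z \<bullet> (B ** (- (transpose B ** Z)))"
        using closure[of 0 0 "- (transpose B ** Z)"] zero by simp
      then have "(transpose B ** Z) \<bullet> (transpose B ** Z) = 0"
        using inner_ge_zero[of "transpose B ** Z"] by (simp add: inner_matrix_mult)
      then show ?thesis by simp
    qed
    show "0 \<le> (A *v x) \<bullet> (Z *v x)" for x
      using closure[of "outer_product x x" 0 0] outer
      by (simp add: mult_outer_product inner_outer_product)
  qed
qed

section \<open>From a separating matrix to a violated Hautus condition\<close>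

text \<open>\<open>(A x) \<bullet> (Z x) \<ge> 0\<close> forces \<open>ker Z\<close> to be \<open>A\<close>-invariant, so its orthogonal complement
  \<open>range Z\<close> is invariant under \<open>transpose A\<close>.\<close>

lemma not_stabilizable_if_separating_matrix:
  fixes A Z :: "real^'n^'n" and B :: "real^'m^'n"
  assumes "Z \<noteq> 0" and sym: "transpose Z = Z" and psd: "\<And>x. 0 \<le> x \<bullet> (Z *v x)"
    and BZ: "transpose B ** Z = 0" and AZ: "\<And>x. 0 \<le> (A *v x) \<bullet> (Z *v x)"
  shows "\<not> stabilizable A B"
proof -
  have Z_comm: "x \<bullet> (Z *v y) = y \<bullet> (Z *v x)" for x y
    using inner_transpose[of x Z y] by (simp add: sym del: transpose_matrix_vector)
  \<comment> \<open>Divide by small \<open>t\<close> of either sign, written as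
    \<open>e * s\<close>; in the limit both \<open>b\<close> and \<open>- b\<close> are
    nonnegative.\<close>
  have nonneg_linear: "b = 0" if "\<And>t. 0 \<le> t * b + t\<^sup>2 * c" for b c :: real
  proof -
    have "0 \<le> s * b" if "s = 1 \<or> s = -1" for s :: real
    proof (rule nonneg_if_nonneg_perturbation)
      fix e :: real assume "e > 0"
      have "0 \<le> (e * s) * b + (e * s)\<^sup>2 * c" by fact
      also have "\<dots> = e * (s * b + e * c)"
        using that by (auto simp: power2_eq_square algebra_simps)
      finally show "0 \<le> s * b + e * c"
        using \<open>e > 0\<close> by (simp add: zero_le_mult_iff)
    qed
    from this[of 1] this[of "-1"] show ?thesis by simp
  qed
  have ker: "Z *v x = 0" if "x \<bullet> (Z *v x) = 0" for x
  proof -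
    have "2 * (y \<bullet> (Z *v x)) = 0" for y
    proof (rule nonneg_linear)
      fix t :: real
      show "0 \<le> t * (2 * (y \<bullet> (Z *v x))) + t\<^sup>2 * (y \<bullet> (Z *v y))"
        using psd[of "x + t *\<^sub>R y"] that Z_comm[of x y]
        by (simp add: matrix_vector_right_distrib matrix_vector_mult_scaleR inner_add_left
            inner_add_right power2_eq_square algebra_simps)
    qed
    from this[of "Z *v x"] show ?thesis by simp
  qed
  \<comment> \<open>Put \<open>x + t *\<^sub>R y\<close> into \<open>AZ\<close>: with
    \<open>x\<close> in the kernel no constant term remains, so the coefficient of \<open>t\<close>
    vanishes.\<close>
  have ker_inv: "Z *v (A *v x) = 0" if "Z *v x = 0" for x
  proof -
    have "(A *v x) \<bullet> (Z *v y) = 0" for y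
    proof (rule nonneg_linear)
      fix t :: real
      show "0 \<le> t * ((A *v x) \<bullet> (Z *v y)) + t\<^sup>2 * ((A *v y) \<bullet> (Z *v y))"
        using AZ[of "x + t *\<^sub>R y"] that
        by (simp add: matrix_vector_right_distrib matrix_vector_mult_scaleR inner_add_left
            inner_add_right power2_eq_square algebra_simps)
    qed
    from this[of "Z *v (A *v x)"] Z_comm show ?thesis
      by (metis inner_eq_zero_iff)
  qed
  define V where "V = range ((*v) Z)"
  have V: "subspace V"
    unfolding V_def by (intro linear_subspace_image subspace_UNIV) simp
  have V_inv: "y v* A \<in> V" if y: "y \<in> V" for y
  proof -
    obtain w where w: "y = Z *v w"
      using y by (auto simp: V_def)
    \<comment> \<open>The component \<open>b\<close> orthogonal to the range lies in the kernel of
      the symmetric \<open>Z\<close>. Kernel invariance makes \<open>y v* A\<close> orthogonal to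
      \<open>b\<close>, which forces \<open>b = 0\<close>.\<close>
    obtain a b where ab: "a \<in> V" "\<And>v. v \<in> V \<Longrightarrow> orthogonal b v" "y v* A = a + b"
      using orthogonal_subspace_decomp_exists[of V "y v* A"] V by (metis span_eq_iff)
    have "b \<bullet> (Z *v x) = 0" for x
      using ab(2)[of "Z *v x"] by (simp add: V_def orthogonal_def)
    then have "Z *v b = 0"
      using Z_comm by (metis inner_eq_zero_iff)
    then have "(y v* A) \<bullet> b = 0"
      using ker_inv[of b] Z_comm[of "A *v b" w] unfolding w dot_lmul_matrix by (simp add: inner_commute)
    moreover have "a \<bullet> b = 0"
      using ab(1,2) by (metis orthogonal_def inner_commute)
    ultimately have "b = 0"
      by (simp add: ab(3) inner_add_left)
    with ab show ?thesis by simp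
  qed
  define re im :: "complex^'n \<Rightarrow> real^'n"
    where "re u = (\<chi> i. Re (u $ i))" and "im u = (\<chi> i. Im (u $ i))" for u
  \<comment> \<open>\<open>S\<close> is the complexification of \<open>V\<close>, where an
    eigenvector is available.\<close>
  define S where "S = {u. re u \<in> V \<and> im u \<in> V}"
  let ?A = "transpose (complex_matrix A)"
  have scale: "re (c *s u) = Re c *\<^sub>R re u - Im c *\<^sub>R im u"
    "im (c *s u) = Im c *\<^sub>R re u + Re c *\<^sub>R im u" for c u
    by (simp_all add: re_def im_def vec_eq_iff)
  have mult: "re (?A *v u) = re u v* A" "im (?A *v u) = im u v* A" for u
    by (simp_all add: re_def im_def vec_eq_iff complex_matrix_def vector_matrix_mult_def)
  have "vec.subspace S"
  proof (rule vec.subspaceI)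
    have "re 0 = 0" "im 0 = 0"
      by (simp_all add: re_def im_def vec_eq_iff)
    then show "0 \<in> S"
      using V by (simp add: S_def subspace_0)
    have "re (u + v) = re u + re v" "im (u + v) = im u + im v" for u v
      by (simp_all add: re_def im_def vec_eq_iff)
    then show "u + v \<in> S" if "u \<in> S" "v \<in> S" for u v
      using that V by (simp add: S_def subspace_add)
    show "c *s u \<in> S" if "u \<in> S" for c u
      using that V by (simp add: S_def scale subspace_add subspace_diff subspace_scale)
  qed
  moreover have "?A *v u \<in> S" if "u \<in> S" for u
    using that V_inv unfolding S_def by (auto simp: mult simp del: transpose_matrix_vector)
  moreover obtain v where "v \<in> S" "v \<noteq> 0"
  proof -
    obtain w where "Z *v w \<noteq> 0"
      using \<open>Z \<noteq> 0\<close> by (metis matrix_eq matrix_vector_mult_0)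
    then have "(\<chi> i. complex_of_real ((Z *v w) $ i)) \<noteq> 0"
      by (auto simp: vec_eq_iff)
    moreover have "re (\<chi> i. complex_of_real ((Z *v w) $ i)) = Z *v w"
      "im (\<chi> i. complex_of_real ((Z *v w) $ i)) = 0"
      by (simp_all add: re_def im_def vec_eq_iff)
    then have "(\<chi> i. complex_of_real ((Z *v w) $ i)) \<in> S"
      using V by (simp add: S_def subspace_0) (simp add: V_def)
    ultimately show ?thesis
      using that by blast
  qed
  ultimately obtain \<mu> u where u: "u \<in> S" "u \<noteq> 0" "?A *v u = \<mu> *s u"
    using invariant_subspace_eigenvector[of S ?A v] by blast
  define p q \<sigma> \<tau> where "p = re u" and "q = im u" and "\<sigma> = Re \<mu>" and "\<tau> = Im \<mu>"
  obtain a b where ab: "p = Z *v a" "q = Z *v b"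
    using u(1) by (auto simp: S_def p_def q_def V_def)
  have pq: "p \<noteq> 0 \<or> q \<noteq> 0"
    using u(2) by (auto simp: p_def q_def re_def im_def vec_eq_iff complex_eq_iff)
  have pA: "p v* A = \<sigma> *\<^sub>R p - \<tau> *\<^sub>R q" and qA: "q v* A = \<tau> *\<^sub>R p + \<sigma> *\<^sub>R q"
    using mult[of u] unfolding u(3) scale by (simp_all add: p_def q_def \<sigma>_def \<tau>_def)
  \<comment> \<open>Pairing with the preimages \<open>a\<close> and \<open>b\<close> cancels the
    \<tau> terms by symmetry of \<open>Z\<close>; what remains is \<sigma> times a sum that is
    positive because \<open>a\<close> and \<open>b\<close> are not both in the kernel.\<close>
  have "0 \<le> (p v* A) \<bullet> a + (q v* A) \<bullet> b"
    using AZ[of a] AZ[of b] unfolding ab dot_lmul_matrix by (simp add: inner_commute)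
  also have "\<dots> = \<sigma> * (a \<bullet> (Z *v a) + b \<bullet> (Z *v b))"
    using Z_comm[of a b]
    by (simp add: pA qA) (simp add: ab inner_add_left inner_diff_left inner_commute algebra_simps)
  finally have "0 \<le> \<sigma> * (a \<bullet> (Z *v a) + b \<bullet> (Z *v b))" .
  moreover have "0 < a \<bullet> (Z *v a) + b \<bullet> (Z *v b)"
    using pq ab ker[of a] ker[of b] psd[of a] psd[of b] by (smt (verit))
  ultimately have "0 \<le> \<sigma>"
    by (simp add: zero_le_mult_iff)
  moreover have "p v* B = 0" "q v* B = 0"
    using BZ by (simp_all add: ab matrix_vector_mul_assoc flip: transpose_matrix_vector)
  ultimately show ?thesis
    unfolding not_stabilizable_iff using pq pA qA by blast
qed

section \<open>Necessity of stabilizability, and the equivalence\<close>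

text \<open>Add the quadratic form at the real and imaginary parts of a violating left eigenvector:
  \<open>B\<close> drops out, symmetry of \<open>X\<close> cancels the \<tau> terms, and a
  nonnegative multiple of \<sigma> is left where a negative value is required.\<close>

lemma stabilizable_if_strictly_feasible:
  fixes A :: "real^'n^'n" and B :: "real^'m^'n"
  assumes X: "X \<in> pd_matrices"
    and neg: "\<And>x. x \<noteq> 0 \<Longrightarrow> x \<bullet> ((A ** X + B ** Y) *v x) < 0"
  shows "stabilizable A B"
proof (rule ccontr)
  assume "\<not> stabilizable A B"
  then obtain \<sigma> \<tau> p q where "\<sigma> \<ge> 0" and pq: "p \<noteq> 0 \<or> q \<noteq> 0"
    and pA: "p v* A = \<sigma> *\<^sub>R p - \<tau> *\<^sub>R q" and qA: "q v* A = \<tau> *\<^sub>R p + \<sigma> *\<^sub>R q"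
    and pB: "p v* B = 0" and qB: "q v* B = 0"
    unfolding not_stabilizable_iff by blast
  let ?H = "A ** X + B ** Y"
  have H: "x \<bullet> (?H *v x) = (x v* A) \<bullet> (X *v x) + (x v* B) \<bullet> (Y *v x)" for x
    by (simp add: dot_lmul_matrix matrix_vector_mult_add_rdistrib inner_add_right
        flip: matrix_vector_mul_assoc)
  have X_comm: "p \<bullet> (X *v q) = q \<bullet> (X *v p)"
    using X inner_transpose[of p X q] by (simp add: pd_matrices_def del: transpose_matrix_vector)
  have X_nonneg: "0 \<le> x \<bullet> (X *v x)" for x
    using X by (cases "x = 0") (auto simp: pd_matrices_def less_imp_le)
  have "p \<bullet> (?H *v p) + q \<bullet> (?H *v q) = \<sigma> * (p \<bullet> (X *v p) + q \<bullet> (X *v q))"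
    using X_comm unfolding H by (simp add: pA qA pB qB inner_add_left inner_diff_left algebra_simps)
  moreover have "0 \<le> \<dots>"
    using \<open>\<sigma> \<ge> 0\<close> X_nonneg by simp
  moreover have "p \<bullet> (?H *v p) + q \<bullet> (?H *v q) < 0"
    using pq neg[of p] neg[of q] by (cases "p = 0"; cases "q = 0") auto
  ultimately show False by linarith
qed

theorem theorem3p3:
  fixes A :: "real^'n^'n" and B1 :: "real^'m1^'n" and B2 :: "real^'m2^'n"
    and C1 :: "real^'n^'p1" and D11 :: "real^'m1^'p1" and D12 :: "real^'m2^'p1"
  shows "lmi_strongly_feasible A B1 B2 C1 D11 D12 \<longleftrightarrow>
         control_system_stabilizable A B1 B2 C1 D11 D12"
  unfolding lmi_strongly_feasible_iff control_system_stabilizable_def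
  by (metis stabilizable_if_strictly_feasible separating_matrix not_stabilizable_if_separating_matrix)

end
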